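(* For any finite, simple, connected signed graph $\Sigma$ and any integer $k\ge 1$, $$\operatorname{bdim}(N_k[\Sigma])=\operatorname{bdim}(\Sigma[N_k])=\operatorname{bdim}(\Sigma),$$ where $N_k$ is the graph on $k$ vertices without edges and $\cdot[\cdot]$ denotes the HG-lexicographic product.
   Context: A signed graph $\Sigma=(G,\sigma)$ is a graph $G=(V,E)$ with a function $\sigma:E\to\{+1,-1\}$. All graphs are finite, simple, connected and undirected unless otherwise mentioned; $N_k$ (regarded as a signed graph with empty signature) and the product $N_k[\Sigma]$ may be disconnected. Let $\Omega=\{-1,0,1\}$, with $\Omega^d\subset\mathbb{R}^d$ carrying the standard inner product $\langle\cdot,\cdot\rangle$. A vector valued switching function ($d$-switching function) for $\Sigma$ is a map $\zeta:V\to\Omega^d$ with $\langle\zeta(u),\zeta(v)\rangle\neq 0$ for every edge $uv\in E$; the switched signed graph $\Sigma^\zeta=(G,\sigma^\zeta)$ has $\sigma^\zeta(uv)=\sigma(uv)\operatorname{sgn}(\langle\zeta(u),\zeta(v)\rangle)$. The balancing dimension $\operatorname{bdim}(\Sigma)$ is the least integer $d\ge 1$ for which there is a $d$-switching function $\zeta:V\to\Omega^d$ such that $\Sigma^\zeta$ is all-positive (every edge has sign $+1$). The lexicographic product $G_1[G_2]$ of graphs has vertex set $V(G_1)\times V(G_2)$, with $(u_i,v_j)$ adjacent to $(u_k,v_l)$ iff $u_i\sim u_k$ in $G_1$, or $u_i=u_k$ and $v_j\sim v_l$ in $G_2$. The HG-lexicographic product $\Sigma_1[\Sigma_2]$ of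 $\Sigma_1=(G_1,\sigma_1)$ and $\Sigma_2=(G_2,\sigma_2)$ is the signed graph on $G_1[G_2]$ with signature $\sigma((u_i,v_j)(u_k,v_l))=\sigma_1(u_iu_k)$ if $i\ne k$, and $=\sigma_2(v_jv_l)$ if $i=k$. *)

theory Defs
  imports "Graph_Theory.Digraph_Component" "Jordan_Normal_Form.Matrix"
begin

text \<open>
  A finite simple undirected graph is a \<^locale>\<open>pair_graph\<close>: an edge \<open>uv\<close> is represented by the two
  arcs \<open>(u, v)\<close> and \<open>(v, u)\<close>, and the signature is symmetric accordingly. Values of the signature
  off the edges are irrelevant.
\<close>

record 'a signed_graph =
  ugraph :: "'a pair_pre_digraph"
  signature :: "'a \<times> 'a \<Rightarrow> real"

abbreviation vertices :: "'a signed_graph \<Rightarrow> 'a set" where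
  "vertices S \<equiv> pverts (ugraph S)"

abbreviation edges :: "'a signed_graph \<Rightarrow> ('a \<times> 'a) set" where
  "edges S \<equiv> parcs (ugraph S)"

locale signed_graph =
  fixes S :: "'a signed_graph"
  assumes pair_graph_ugraph: "pair_graph (ugraph S)"
    and signature_values: "e \<in> edges S \<Longrightarrow> signature S e \<in> {1, -1}"
    and signature_sym: "(u, v) \<in> edges S \<Longrightarrow> signature S (v, u) = signature S (u, v)"

definition all_positive :: "'a signed_graph \<Rightarrow> bool" where
  "all_positive S \<longleftrightarrow> (\<forall>e \<in> edges S. signature S e = 1)"

definition Omega :: "nat \<Rightarrow> real vec set" where
  "Omega d = {x \<in> carrier_vec d. \<forall>i < d. x $ i \<in> {-1, 0, 1}}"

text \<open>A switching function is a function on the vertex set; its values elsewhere are irrelevant.\<close>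

definition switching_function :: "nat \<Rightarrow> 'a signed_graph \<Rightarrow> ('a \<Rightarrow> real vec) \<Rightarrow> bool" where
  "switching_function d S \<zeta> \<longleftrightarrow>
     (\<forall>v \<in> vertices S. \<zeta> v \<in> Omega d) \<and>
     (\<forall>(u, v) \<in> edges S. scalar_prod (\<zeta> u) (\<zeta> v) \<noteq> 0)"

definition switched :: "'a signed_graph \<Rightarrow> ('a \<Rightarrow> real vec) \<Rightarrow> 'a signed_graph" where
  "switched S \<zeta> =
     \<lparr> ugraph = ugraph S,
       signature = (\<lambda>(u, v). signature S (u, v) * sgn (scalar_prod (\<zeta> u) (\<zeta> v))) \<rparr>"

definition bdim :: "'a signed_graph \<Rightarrow> nat" where
  "bdim S = (LEAST d. 1 \<le> d \<and> (\<exists>\<zeta>. switching_function d S \<zeta> \<and> all_positive (switched S \<zeta>)))"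

definition lex_product ::
  "'a pair_pre_digraph \<Rightarrow> 'b pair_pre_digraph \<Rightarrow> ('a \<times> 'b) pair_pre_digraph" where
  "lex_product G H =
     \<lparr> pverts = pverts G \<times> pverts H,
       parcs = {((u, v), (u', v')) | u v u' v'.
         (u, v) \<in> pverts G \<times> pverts H \<and> (u', v') \<in> pverts G \<times> pverts H \<and>
         ((u, u') \<in> parcs G \<or> u = u' \<and> (v, v') \<in> parcs H)} \<rparr>"

definition HG_lex_product ::
  "'a signed_graph \<Rightarrow> 'b signed_graph \<Rightarrow> ('a \<times> 'b) signed_graph" where
  "HG_lex_product S T =
     \<lparr> ugraph = lex_product (ugraph S) (ugraph T),
       signature = (\<lambda>((u, v), (u', v')).
         if u \<noteq> u' then signature S (u, u') else signature T (v, v')) \<rparr>"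

text \<open>
  The edgeless graph on \<open>k\<close> vertices. Its signature is empty; the total function used here is a
  dummy, as there is no edge at which it could be evaluated.
\<close>

definition N :: "nat \<Rightarrow> nat signed_graph" where
  "N k = \<lparr> ugraph = \<lparr> pverts = {0..<k}, parcs = {} \<rparr>, signature = (\<lambda>_. 1) \<rparr>"

lemma signed_graph_iff:
  "signed_graph S \<longleftrightarrow>
     finite (vertices S) \<and> edges S \<subseteq> vertices S \<times> vertices S \<and>
     irrefl (edges S) \<and> sym (edges S) \<and>
     (\<forall>e \<in> edges S. signature S e \<in> {1, -1}) \<and>
     (\<forall>(u, v) \<in> edges S. signature S (v, u) = signature S (u, v))"
  (is "?L \<longleftrightarrow> ?R")
proof
  assume ?L
  then interpret signed_graph S .
  interpret pair_graph "ugraph S" by (rule pair_graph_ugraph)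
  have "sym (edges S)"
    using pair_sym_arcs by (simp add: symmetric_def)
  moreover have "irrefl (edges S)"
    using pair_no_loops by (fastforce simp: irrefl_def)
  ultimately show ?R
    using pair_finite_verts in_arcsD1 in_arcsD2 signature_values signature_sym
    by (intro conjI) auto
next
  assume R: ?R
  then have "finite (edges S)"
    using finite_subset by blast
  with R have "pair_graph (ugraph S)"
    by unfold_locales (auto simp: symmetric_def irrefl_def)
  with R show ?L
    by (intro signed_graph.intro) auto
qed

lemma signed_graph_N: "signed_graph (N k)"
  by (auto simp: signed_graph_iff N_def irrefl_def sym_def)

lemma signed_graph_HG_lex_product:
  assumes "signed_graph S" "signed_graph T"
  shows "signed_graph (HG_lex_product S T)"
proof -
  have S: "finite (vertices S)" "irrefl (edges S)" "sym (edges S)"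
    "\<And>e. e \<in> edges S \<Longrightarrow> signature S e \<in> {1, -1}"
    "\<And>u v. (u, v) \<in> edges S \<Longrightarrow> signature S (v, u) = signature S (u, v)"
    using assms(1) unfolding signed_graph_iff by auto
  have T: "finite (vertices T)" "irrefl (edges T)" "sym (edges T)"
    "\<And>e. e \<in> edges T \<Longrightarrow> signature T e \<in> {1, -1}"
    "\<And>u v. (u, v) \<in> edges T \<Longrightarrow> signature T (v, u) = signature T (u, v)"
    using assms(2) unfolding signed_graph_iff by auto
  note symS = symD[OF S(3)] and symT = symD[OF T(3)]
  let ?P = "HG_lex_product S T"
  have "finite (vertices ?P)" "edges ?P \<subseteq> vertices ?P \<times> vertices ?P"
    using S(1) T(1) by (auto simp: HG_lex_product_def lex_product_def)
  moreover have "irrefl (edges ?P)"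
    using S(2) T(2) by (auto simp: HG_lex_product_def lex_product_def irrefl_def)
  moreover have "sym (edges ?P)"
    using symS symT by (auto simp: HG_lex_product_def lex_product_def intro!: symI)
  moreover have "\<forall>e \<in> edges ?P. signature ?P e \<in> {1, -1}"
    using S(2,4) T(4)
    by (fastforce simp: HG_lex_product_def lex_product_def irrefl_def)
  moreover have "\<forall>(u, v) \<in> edges ?P. signature ?P (v, u) = signature ?P (u, v)"
    using S(2,5) T(5) by (auto simp: HG_lex_product_def lex_product_def irrefl_def)
  ultimately show ?thesis
    unfolding signed_graph_iff by blast
qed

text \<open>
  The set minimised in \<^const>\<open>bdim\<close> is never empty: with one coordinate per arc \<open>(a, b)\<close>, let the
  entry at that coordinate be \<open>1\<close> at \<open>a\<close>, the sign of the arc at \<open>b\<close>, and \<open>0\<close> elsewhere; then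
  adjacent \<open>u\<close>, \<open>v\<close> have inner product twice the sign of \<open>uv\<close>. A further zero coordinate
  ensures \<open>d \<ge> 1\<close>.
\<close>

lemma balancing_switching_function_exists:
  assumes "signed_graph S"
  shows "\<exists>d \<ge> 1. \<exists>\<zeta>. switching_function d S \<zeta> \<and> all_positive (switched S \<zeta>)"
proof -
  interpret signed_graph S by fact
  have S: "irrefl (edges S)" "sym (edges S)"
    "\<And>e. e \<in> edges S \<Longrightarrow> signature S e \<in> {1, -1}"
    "\<And>u v. (u, v) \<in> edges S \<Longrightarrow> signature S (v, u) = signature S (u, v)"
    using assms unfolding signed_graph_iff by auto
  have fin: "finite (edges S)"
    using assms unfolding signed_graph_iff by (meson finite_SigmaI finite_subset)
  define d where "d = card (edges S)"
  obtain arc where arc: "bij_betw arc {0..<d} (edges S)"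
    using ex_bij_betw_nat_finite[OF fin] unfolding d_def by blast
  define f where "f v e = (if v = fst e then 1 else if v = snd e then signature S e else 0)"
    for v e
  define \<zeta> where "\<zeta> v = vec (Suc d) (\<lambda>i. if i < d then f v (arc i) else 0)" for v
  have \<zeta>_Omega: "\<zeta> v \<in> Omega (Suc d)" for v
  proof -
    have "signature S (arc i) \<in> {1, -1}" if "i < d" for i
      using arc that by (intro S(3)) (auto simp: bij_betw_def)
    then show ?thesis
      unfolding Omega_def \<zeta>_def f_def by auto
  qed
  have ip: "scalar_prod (\<zeta> u) (\<zeta> v) = 2 * signature S (u, v)" if uv: "(u, v) \<in> edges S" for u v
  proof -
    have "u \<noteq> v" using S(1) uv by (auto simp: irrefl_def)
    have vu: "(v, u) \<in> edges S" using S(2) uv by (auto dest: symD)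
    have "scalar_prod (\<zeta> u) (\<zeta> v) = (\<Sum>i\<in>{0..<d}. f u (arc i) * f v (arc i))"
      unfolding scalar_prod_def \<zeta>_def by simp
    also have "\<dots> = (\<Sum>e\<in>edges S. f u e * f v e)"
      using sum.reindex_bij_betw[OF arc, of "\<lambda>e. f u e * f v e"] .
    also have "\<dots> = (\<Sum>e\<in>{(u, v), (v, u)}. f u e * f v e)"
      using \<open>u \<noteq> v\<close> uv vu fin by (intro sum.mono_neutral_right) (auto simp: f_def split: if_splits)
    also have "\<dots> = 2 * signature S (u, v)"
      using \<open>u \<noteq> v\<close> S(4)[OF uv] by (simp add: f_def)
    finally show ?thesis .
  qed
  have "switching_function (Suc d) S \<zeta>"
    using \<zeta>_Omega ip S(3) unfolding switching_function_def by fastforce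
  moreover have "all_positive (switched S \<zeta>)"
    using ip S(3) unfolding all_positive_def switched_def by fastforce
  ultimately show ?thesis
    by (intro exI[of _ "Suc d"]) auto
qed

end

theory Submission
  imports Defs
begin

text \<open>
  A balancing switching function pulls back along any sign-preserving graph homomorphism. There are
  such homomorphisms in both directions between \<open>\<Sigma>\<close> and each of the two products: the
  projection onto the factor \<open>\<Sigma>\<close>, and the inclusion as the fibre over the vertex \<open>0\<close> of \<open>N\<^sub>k\<close>.
\<close>

text \<open>Injectivity is not imposed: the projections can identify vertices.\<close>

definition signed_hom :: "'a signed_graph \<Rightarrow> 'b signed_graph \<Rightarrow> ('a \<Rightarrow> 'b) \<Rightarrow> bool" where
  "signed_hom S T f \<longleftrightarrow>
     f ` vertices S \<subseteq> vertices T \<and>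
     (\<forall>(u, v) \<in> edges S. (f u, f v) \<in> edges T \<and> signature T (f u, f v) = signature S (u, v))"

text \<open>The inner product at an edge \<open>uv\<close> of \<open>S\<close> is the one at its
  image in \<open>T\<close>, and the two signs agree.\<close>

lemma signed_hom_pullback:
  assumes "signed_hom S T f" "switching_function d T \<zeta>" "all_positive (switched T \<zeta>)"
  shows "switching_function d S (\<zeta> \<circ> f)" "all_positive (switched S (\<zeta> \<circ> f))"
  using assms
  unfolding signed_hom_def switching_function_def all_positive_def switched_def
  by fastforce+

text \<open>Pulling back keeps \<open>d\<close>, so both minima run over the same set.\<close>

lemma bdim_eq_if_signed_homs:
  assumes "signed_hom S T f" "signed_hom T S g"
  shows "bdim S = bdim T"
proof -
  have "(\<exists>\<zeta>. switching_function d S \<zeta> \<and> all_positive (switched S \<zeta>)) \<longleftrightarrow>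
        (\<exists>\<zeta>. switching_function d T \<zeta> \<and> all_positive (switched T \<zeta>))" for d
    using signed_hom_pullback[OF assms(1)] signed_hom_pullback[OF assms(2)] by metis
  then show ?thesis
    unfolding bdim_def by simp
qed

lemma bdim_N_HG_lex_product:
  assumes "signed_graph S" "k \<ge> 1"
  shows "bdim (HG_lex_product (N k) S) = bdim S"
proof (rule bdim_eq_if_signed_homs)
  have S: "edges S \<subseteq> vertices S \<times> vertices S"
    using assms(1) unfolding signed_graph_iff by auto
  \<comment> \<open>As \<open>N k\<close> has no arcs, each arc of the product stays in one copy of
    \<open>S\<close> and has its sign from there.\<close>
  show "signed_hom (HG_lex_product (N k) S) S snd"
    by (auto simp: signed_hom_def HG_lex_product_def lex_product_def N_def)
  show "signed_hom S (HG_lex_product (N k) S) (Pair 0)"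
    using S assms(2) by (auto simp: signed_hom_def HG_lex_product_def lex_product_def N_def)
qed

lemma bdim_HG_lex_product_N:
  assumes "signed_graph S" "k \<ge> 1"
  shows "bdim (HG_lex_product S (N k)) = bdim S"
proof (rule bdim_eq_if_signed_homs)
  have S: "edges S \<subseteq> vertices S \<times> vertices S" "irrefl (edges S)"
    using assms(1) unfolding signed_graph_iff by auto
  \<comment> \<open>Each arc lies over an arc of \<open>S\<close>. As \<open>S\<close> has no loops,
    its ends differ in the first component, so the sign is taken from \<open>S\<close>.\<close>
  show "signed_hom (HG_lex_product S (N k)) S fst"
    using S by (auto simp: signed_hom_def HG_lex_product_def lex_product_def N_def irrefl_def)
  show "signed_hom S (HG_lex_product S (N k)) (\<lambda>v. (v, 0))"
    using S assms(2)
    by (auto simp: signed_hom_def HG_lex_product_def lex_product_def N_def irrefl_def)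
qed

theorem proposition2p12:
  fixes S :: "'a signed_graph" and k :: nat
  assumes "signed_graph S" and "connected (ugraph S)" and "k \<ge> 1"
  shows "bdim (HG_lex_product (N k) S) = bdim (HG_lex_product S (N k)) \<and>
         bdim (HG_lex_product S (N k)) = bdim S"
  using assms bdim_N_HG_lex_product bdim_HG_lex_product_N by metis

end
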